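(* A Minkowski plane $(M,\|\cdot\|)$ is Euclidean if and only if for any $\mathcal{C}$-orthocentric system $\{p_1,p_2,p_3,p_4\}$ with $\|p_3-p_1\|=\|p_3-p_2\|$ (and $p_3\neq\frac{p_1+p_2}{2}$, so that the line below is defined), it holds that $p_4\in\left\langle p_3,\frac{p_1+p_2}{2}\right\rangle$.
   Context: A Minkowski plane is a real two-dimensional normed linear space; it is Euclidean if its norm is induced by an inner product. For $x\ne y$, $\langle x,y\rangle$ denotes the line through $x$ and $y$. $S_p(w)=2p-w$ is the symmetry with center $p$. For points $a,b,c\in M$, the set of circumcenters is $\mathcal{C}(\triangle abc)=\{x\in M:\|x-a\|=\|x-b\|=\|x-c\|\}$. $\mathcal{C}$-orthocenter: given points $a,b,c\in M$ and $o\in\mathcal{C}(\triangle abc)$, put $q=\frac{a+b+c-o}{2}$, which is the point of symmetry between $\triangle abc$ and the triangle whose vertices are the images of $o$ under the symmetries at the midpoints of the sides $[b,c],[a,c],[a,b]$. The $\mathcal{C}$-orthocenter of $\triangle abc$ associated with $o$ is $S_q(o)=a+b+c-2o$. $\mathcal{C}$-orthocentric system: four points $p_1,p_2,p_3,p_4\in M$ form a $\mathcal{C}$-orthocentric system $\{p_1,p_2,p_3,p_4\}$ if for some labeling $\{i,j,k,l\}=\{1,2,3,4\}$ there is a circumcenter $x_i\in\mathcal{C}(\triangle p_jp_kp_l)$ such that $p_i$ is the $\mathcal{C}$-orthocenter of $\triangle p_jp_kp_l$ associated with $x_i$. *)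

theory Defs
  imports "HOL-Analysis.Analysis"
begin

(* dim is 0 for infinite-dimensional spaces, so dimension 2 is exact. *)
definition minkowski_plane :: "'a::real_normed_vector itself \<Rightarrow> bool" where
  "minkowski_plane _ \<longleftrightarrow> dim (UNIV :: 'a set) = 2"

definition inner_product_form :: "('a::real_vector \<Rightarrow> 'a \<Rightarrow> real) \<Rightarrow> bool" where
  "inner_product_form B \<longleftrightarrow>
     bilinear B \<and> (\<forall>x y. B x y = B y x) \<and> (\<forall>x. x \<noteq> 0 \<longrightarrow> B x x > 0)"

definition euclidean_norm :: "'a::real_normed_vector itself \<Rightarrow> bool" where
  "euclidean_norm _ \<longleftrightarrow>
     (\<exists>B :: 'a \<Rightarrow> 'a \<Rightarrow> real. inner_product_form B \<and> (\<forall>x. norm x = sqrt (B x x)))"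

definition point_symmetry :: "'a::real_vector \<Rightarrow> 'a \<Rightarrow> 'a" where
  "point_symmetry p w = 2 *\<^sub>R p - w"

definition circumcenters :: "'a::real_normed_vector \<Rightarrow> 'a \<Rightarrow> 'a \<Rightarrow> 'a set" where
  "circumcenters a b c = {x. norm (x - a) = norm (x - b) \<and> norm (x - b) = norm (x - c)}"

definition symmetry_center :: "'a::real_vector \<Rightarrow> 'a \<Rightarrow> 'a \<Rightarrow> 'a \<Rightarrow> 'a" where
  "symmetry_center a b c z = (1/2) *\<^sub>R (a + b + c - z)"

definition C_orthocenter :: "'a::real_vector \<Rightarrow> 'a \<Rightarrow> 'a \<Rightarrow> 'a \<Rightarrow> 'a" where
  "C_orthocenter a b c z = point_symmetry (symmetry_center a b c z) z"

(* A system is a set of four (hence pairwise distinct) points; the enumeration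
   P = {a, b, c, d} together with card P = 4 is the choice of a labeling. *)
definition C_orthocentric_system :: "'a::real_normed_vector set \<Rightarrow> bool" where
  "C_orthocentric_system P \<longleftrightarrow>
     card P = 4 \<and>
     (\<exists>a b c d. P = {a, b, c, d} \<and>
        (\<exists>x \<in> circumcenters a b c. d = C_orthocenter a b c x))"

lemma C_orthocenter_eq: "C_orthocenter a b c z = a + b + c - 2 *\<^sub>R z"
  by (simp add: C_orthocenter_def point_symmetry_def symmetry_center_def scaleR_2)

lemma symmetry_center_vertex:
  "point_symmetry (symmetry_center a b c z) a = point_symmetry (midpoint b c) z"
  by (simp add: point_symmetry_def symmetry_center_def midpoint_def)

end

theory Submission
  imports Defs
begin

text \<open>With the circumcenter as origin, an orthocentric system consists of three points \<open>a\<close>, \<open>b\<close>,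
  \<open>c\<close> of a common norm together with \<open>a + b + c\<close>, and the bisector condition says: if \<open>a\<close>, \<open>b\<close>, \<open>c\<close>
  are unit vectors and \<open>c\<close> is equidistant from \<open>a\<close> and \<open>b\<close>, then \<open>a + b\<close> is parallel to \<open>c\<close>.
  This forces strict convexity, and then says the following about the norm
  \<open>g t = norm (u + t c)\<close> along a line with unit direction \<open>c\<close>: if \<open>g s = g t = \<rho>\<close> with \<open>s < t\<close>,
  then \<open>g (s - \<rho>) = g (t + \<rho>)\<close>. Iterating, one obtains arbitrarily long chords with the same
  midpoint, whose position is determined by the asymptotics of \<open>g\<close>. Hence all chords of \<open>g\<close>
  have the same midpoint, so isosceles orthogonality \<open>norm (u + v) = norm (u - v)\<close> is homogeneous,
  which makes the norm Euclidean.

  Conversely, in a Euclidean plane \<open>p4 - p3\<close> and \<open>p3 - midpoint p1 p2\<close> are both orthogonal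
  to \<open>p2 - p1\<close>.\<close>

section \<open>Coordinates in a plane\<close>

text \<open>Independence of the pair rather than of the set: \<open>independent {u, v}\<close> would
  also hold for \<open>u = v\<close> nonzero.\<close>

definition indep2 :: "'a::real_vector \<Rightarrow> 'a \<Rightarrow> bool" where
  "indep2 u v \<longleftrightarrow> (\<forall>p q. p *\<^sub>R u + q *\<^sub>R v = 0 \<longrightarrow> p = 0 \<and> q = 0)"

lemma indep2D: "indep2 u v \<Longrightarrow> p *\<^sub>R u + q *\<^sub>R v = 0 \<Longrightarrow> p = 0 \<and> q = 0"
  by (simp add: indep2_def)

lemma indep2_eq_iff:
  assumes "indep2 u v"
  shows "p *\<^sub>R u + q *\<^sub>R v = p' *\<^sub>R u + q' *\<^sub>R v \<longleftrightarrow> p = p' \<and> q = q'"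
proof
  assume "p *\<^sub>R u + q *\<^sub>R v = p' *\<^sub>R u + q' *\<^sub>R v"
  then have "(p - p') *\<^sub>R u + (q - q') *\<^sub>R v = 0"
    by (simp add: algebra_simps)
  with assms have "p - p' = 0 \<and> q - q' = 0"
    by (rule indep2D)
  then show "p = p' \<and> q = q'" by simp
qed simp

lemma indep2_combination:
  assumes "indep2 u v" and "p * q' - q * p' \<noteq> 0"
  shows "indep2 (p *\<^sub>R u + q *\<^sub>R v) (p' *\<^sub>R u + q' *\<^sub>R v)"
  unfolding indep2_def
proof (intro allI impI)
  fix x y
  assume "x *\<^sub>R (p *\<^sub>R u + q *\<^sub>R v) + y *\<^sub>R (p' *\<^sub>R u + q' *\<^sub>R v) = 0"
  then have "(x * p + y * p') *\<^sub>R u + (x * q + y * q') *\<^sub>R v = 0"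
    by (simp add: algebra_simps)
  then have e: "x * p + y * p' = 0" "x * q + y * q' = 0"
    using indep2D[OF assms(1)] by blast+
  \<comment> \<open>Cramer's rule.\<close>
  have "x * (p * q' - q * p') = (x * p + y * p') * q' - (x * q + y * q') * p'"
    "y * (p * q' - q * p') = (x * q + y * q') * p - (x * p + y * p') * q"
    by (simp_all add: algebra_simps)
  then show "x = 0 \<and> y = 0"
    using e assms(2) by auto
qed

lemma indep2_nonzero: "indep2 u v \<Longrightarrow> p \<noteq> 0 \<or> q \<noteq> 0 \<Longrightarrow> p *\<^sub>R u + q *\<^sub>R v \<noteq> 0"
  using indep2D by blast

lemma indep2_line_nonzero: "indep2 u v \<Longrightarrow> u + t *\<^sub>R v \<noteq> 0"
  using indep2_nonzero[of u v 1 t] by simp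

lemma indep2_nonzeroD: "indep2 u v \<Longrightarrow> u \<noteq> 0" "indep2 u v \<Longrightarrow> v \<noteq> 0"
  using indep2_nonzero[of u v 1 0] indep2_nonzero[of u v 0 1] by auto

lemma indep2I:
  assumes "v \<noteq> 0" and "\<And>t. u \<noteq> t *\<^sub>R v"
  shows "indep2 u v"
  unfolding indep2_def
proof (intro allI impI)
  fix p q
  assume e: "p *\<^sub>R u + q *\<^sub>R v = 0"
  have "p = 0"
  proof (rule ccontr)
    assume p: "p \<noteq> 0"
    have "u = (1 / p) *\<^sub>R (p *\<^sub>R u + q *\<^sub>R v) - (q / p) *\<^sub>R v"
      using p by (simp add: scaleR_right_distrib)
    then have "u = (- (q / p)) *\<^sub>R v"
      using e by simp
    then show False using assms(2) by blast
  qed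
  with e assms(1) show "p = 0 \<and> q = 0" by simp
qed

lemma plane_basis:
  assumes "dim (UNIV :: 'a::real_vector set) = 2"
  obtains e f :: "'a::real_vector" where "indep2 e f"
proof -
  obtain B :: "'a set" where B: "independent B" "card B = 2"
    using real_vector.basis_exists[of "UNIV :: 'a set"] assms by metis
  then obtain e f where ef: "B = {e, f}" "e \<noteq> f"
    by (meson card_2_iff)
  have "f \<noteq> 0" "e \<notin> span {f}"
    using B ef real_vector.dependent_zero real_vector.independent_insert[of e "{f}"] by auto
  then have "indep2 e f"
    by (intro indep2I) (auto simp: span_singleton)
  then show ?thesis by (rule that)
qed

lemma plane_coordinates:
  fixes u v x :: "'a::real_vector"
  assumes "dim (UNIV :: 'a set) = 2" and "indep2 u v"
  obtains p q where "x = p *\<^sub>R u + q *\<^sub>R v"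
proof -
  obtain B :: "'a set" where B: "independent B" "UNIV \<subseteq> span B" "card B = 2"
    using real_vector.basis_exists[of "UNIV :: 'a set"] assms(1) by metis
  \<comment> \<open>An infinite set would have \<open>card\<close> 0.\<close>
  have fB: "finite B"
    using B(3) card.infinite by fastforce
  have uv: "u \<noteq> v" "v \<noteq> 0"
    using indep2D[OF assms(2), of 1 "-1"] indep2_nonzeroD[OF assms(2)] by auto
  have "u \<notin> span {v}"
    using indep2D[OF assms(2), of 1 "- k" for k] by (auto simp: span_singleton)
  then have ind: "independent {u, v}"
    using uv by (simp add: real_vector.independent_insert)
  have "x \<in> span {u, v}"
  proof (rule ccontr)
    assume nx: "x \<notin> span {u, v}"
    have "independent {x, u, v}"
      using real_vector.independent_insertI[OF nx ind] .
    then have "card {x, u, v} \<le> card B"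
      using real_vector.independent_span_bound[OF fB] B(2) by blast
    moreover have "x \<noteq> u" "x \<noteq> v"
      using nx span_base[of _ "{u, v}"] by auto
    ultimately show False
      using uv B(3) by simp
  qed
  then obtain p where "x - p *\<^sub>R u \<in> span {v}"
    using span_breakdown_eq[of x u "{v}"] by auto
  then obtain q where "x - p *\<^sub>R u = q *\<^sub>R v"
    by (auto simp: span_singleton)
  then have "x = p *\<^sub>R u + q *\<^sub>R v"
    by (simp add: algebra_simps)
  then show ?thesis by (rule that)
qed

section \<open>The norm along a line\<close>

lemma norm_line_convex:
  fixes u v :: "'a::real_normed_vector"
  assumes "x \<le> y" "y \<le> z"
  shows "(z - x) * norm (u + y *\<^sub>R v) \<le>
    (z - y) * norm (u + x *\<^sub>R v) + (y - x) * norm (u + z *\<^sub>R v)"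
proof -
  have "(z - x) *\<^sub>R (u + y *\<^sub>R v) =
      (z - y) *\<^sub>R (u + x *\<^sub>R v) + (y - x) *\<^sub>R (u + z *\<^sub>R v)"
    by (simp add: algebra_simps)
  then have "norm ((z - x) *\<^sub>R (u + y *\<^sub>R v)) \<le>
      norm ((z - y) *\<^sub>R (u + x *\<^sub>R v)) + norm ((y - x) *\<^sub>R (u + z *\<^sub>R v))"
    by (metis norm_triangle_ineq)
  then show ?thesis
    using assms by simp
qed

text \<open>For \<open>t \<le> y\<close> the point \<open>y\<close> lies between \<open>t\<close>
  and \<open>z\<close>, so by convexity a value below \<open>\<rho>\<close> at \<open>t\<close>
  would pull the value at \<open>y\<close> below \<open>\<rho>\<close>. For \<open>t > y\<close> the
  point \<open>x\<close> replaces \<open>z\<close>.\<close>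

lemma norm_line_flat_minimal:
  fixes u v :: "'a::real_normed_vector"
  assumes "x < y" "y < z"
    and "norm (u + x *\<^sub>R v) = \<rho>" "norm (u + y *\<^sub>R v) = \<rho>" "norm (u + z *\<^sub>R v) = \<rho>"
  shows "\<rho> \<le> norm (u + t *\<^sub>R v)"
proof (cases "t \<le> y")
  case True
  have "(z - y) * \<rho> \<le> (z - y) * norm (u + t *\<^sub>R v)"
    using norm_line_convex[of t y z u v] True assms by (simp add: algebra_simps)
  then show ?thesis using assms(2) by simp
next
  case False
  have "(y - x) * \<rho> \<le> (y - x) * norm (u + t *\<^sub>R v)"
    using norm_line_convex[of x y t u v] False assms by (simp add: algebra_simps)
  then show ?thesis using assms(1) by simp
qed

lemma norm_line_lower_bound:
  fixes u c :: "'a::real_normed_vector"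
  assumes "norm c = 1"
  shows "\<bar>t\<bar> - norm u \<le> norm (u + t *\<^sub>R c)"
  using norm_diff_ineq[of "t *\<^sub>R c" u] assms by (simp add: add.commute)

lemma continuous_on_norm_line [continuous_intros]:
  fixes u v :: "'a::real_normed_vector"
  shows "continuous_on S (\<lambda>t. norm (u + t *\<^sub>R v))"
  by (intro continuous_intros)

section \<open>Asymptotics of the norm at the two ends of a line\<close>

lemma decreasing_limit_at_infinity:
  fixes \<phi> :: "real \<Rightarrow> real"
  assumes "antimono \<phi>" and "\<And>t. l \<le> \<phi> t"
  obtains D where "\<And>\<epsilon>. \<epsilon> > 0 \<Longrightarrow> \<exists>T. \<forall>t\<ge>T. \<bar>\<phi> t - D\<bar> < \<epsilon>"
proof (rule that[of "Inf (range \<phi>)"])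
  fix \<epsilon> :: real
  assume e: "\<epsilon> > 0"
  have bdd: "bdd_below (range \<phi>)"
    using assms(2) by (intro bdd_belowI[of _ l]) auto
  have "Inf (range \<phi>) < Inf (range \<phi>) + \<epsilon>" using e by simp
  then have "\<exists>x\<in>range \<phi>. x < Inf (range \<phi>) + \<epsilon>"
    by (intro cInf_lessD) auto
  then obtain T where T: "\<phi> T < Inf (range \<phi>) + \<epsilon>"
    by blast
  have "\<bar>\<phi> t - Inf (range \<phi>)\<bar> < \<epsilon>" if "t \<ge> T" for t
  proof -
    have "\<phi> t \<le> \<phi> T" using assms(1) that by (simp add: antimonoD)
    moreover have "Inf (range \<phi>) \<le> \<phi> t" using bdd by (simp add: cInf_lower)
    ultimately show ?thesis using T e by linarith
  qed
  then show "\<exists>T. \<forall>t\<ge>T. \<bar>\<phi> t - Inf (range \<phi>)\<bar> < \<epsilon>" by blast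
qed

text \<open>A step along the unit vector \<open>c\<close> raises the norm by at most its length, so
  the norm minus \<open>t\<close> is antitone; it is bounded below by
  \<open>- norm u\<close>.\<close>

lemma norm_line_asymptote:
  fixes u c :: "'a::real_normed_vector"
  assumes "norm c = 1"
  obtains D where "\<And>\<epsilon>. \<epsilon> > 0 \<Longrightarrow> \<exists>T. \<forall>t\<ge>T. \<bar>norm (u + t *\<^sub>R c) - t - D\<bar> < \<epsilon>"
proof -
  let ?f = "\<lambda>t. norm (u + t *\<^sub>R c) - t"
  have "antimono ?f"
  proof (rule antimonoI)
    fix s t :: real
    assume "s \<le> t"
    have "u + t *\<^sub>R c = (u + s *\<^sub>R c) + (t - s) *\<^sub>R c"
      by (simp add: algebra_simps)
    then have "norm (u + t *\<^sub>R c) \<le> norm (u + s *\<^sub>R c) + norm ((t - s) *\<^sub>R c)"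
      by (metis norm_triangle_ineq)
    then show "?f t \<le> ?f s" using \<open>s \<le> t\<close> assms by simp
  qed
  moreover have "- norm u \<le> ?f t" for t
    using norm_line_lower_bound[OF assms, of t u] by linarith
  ultimately show ?thesis
    using decreasing_limit_at_infinity[of ?f] that by blast
qed

text \<open>Far out, the norm behaves like \<open>t + D\<close> along \<open>c\<close> and like
  \<open>t + E\<close> along \<open>- c\<close>. Long chords with midpoint \<open>n\<close> have
  equal norms at their ends, so \<open>n + h + D\<close> and \<open>h - n + E\<close> come
  arbitrarily close, which forces \<open>2 * n = E - D\<close>.\<close>

lemma asymptotic_midpoint_unique:
  fixes u c :: "'a::real_normed_vector"
  assumes c: "norm c = 1"
    and m: "\<And>T. \<exists>h\<ge>T. norm (u + (m + h) *\<^sub>R c) = norm (u + (m - h) *\<^sub>R c)"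
    and m': "\<And>T. \<exists>h\<ge>T. norm (u + (m' + h) *\<^sub>R c) = norm (u + (m' - h) *\<^sub>R c)"
  shows "m = m'"
proof -
  obtain D where D: "\<And>\<epsilon>. \<epsilon> > 0 \<Longrightarrow> \<exists>T. \<forall>t\<ge>T. \<bar>norm (u + t *\<^sub>R c) - t - D\<bar> < \<epsilon>"
    using norm_line_asymptote[OF c] by blast
  have c': "norm (- c) = 1" using c by simp
  obtain E where E: "\<And>\<epsilon>. \<epsilon> > 0 \<Longrightarrow> \<exists>T. \<forall>t\<ge>T. \<bar>norm (u + t *\<^sub>R (- c)) - t - E\<bar> < \<epsilon>"
    using norm_line_asymptote[OF c'] by blast
  have key: "2 * n = E - D"
    if n: "\<And>T. \<exists>h\<ge>T. norm (u + (n + h) *\<^sub>R c) = norm (u + (n - h) *\<^sub>R c)" for n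
  proof (rule ccontr)
    assume "2 * n \<noteq> E - D"
    then have e: "\<bar>2 * n - (E - D)\<bar> / 2 > 0" (is "?e > 0") by simp
    obtain T where T: "\<forall>t\<ge>T. \<bar>norm (u + t *\<^sub>R c) - t - D\<bar> < ?e" using D[OF e] by blast
    obtain T' where T': "\<forall>t\<ge>T'. \<bar>norm (u + t *\<^sub>R (- c)) - t - E\<bar> < ?e" using E[OF e] by blast
    obtain h where h: "h \<ge> \<bar>T\<bar> + \<bar>T'\<bar> + \<bar>n\<bar>"
      "norm (u + (n + h) *\<^sub>R c) = norm (u + (n - h) *\<^sub>R c)"
      using n by blast
    have "\<bar>norm (u + (n + h) *\<^sub>R c) - (n + h) - D\<bar> < ?e"
      using T h(1) by (simp add: abs_le_iff)
    moreover have "\<bar>norm (u + (h - n) *\<^sub>R (- c)) - (h - n) - E\<bar> < ?e"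
      using T' h(1) by (simp add: abs_le_iff)
    moreover have "u + (h - n) *\<^sub>R (- c) = u + (n - h) *\<^sub>R c"
      by (simp add: algebra_simps)
    ultimately show False
      using h(2) by (smt (verit) field_sum_of_halves)
  qed
  show ?thesis using key[OF m] key[OF m'] by simp
qed

text \<open>The normalised points \<open>y t\<close> trace the half of the unit circle on the side
  of \<open>x\<close>, from \<open>- c\<close> to \<open>c\<close>. Their distance
  \<open>f t\<close> from \<open>- c\<close> runs continuously from 0 to 2. The sign of
  \<open>\<alpha>\<close> records the side.\<close>

lemma unit_arc_distance:
  fixes x c :: "'a::real_normed_vector"
  assumes ind: "indep2 x c" and c: "norm c = 1" and \<rho>: "0 < \<rho>" "\<rho> < 2"
  obtains \<alpha> \<beta> where "\<alpha> > 0" "norm (\<alpha> *\<^sub>R x + \<beta> *\<^sub>R c) = 1" "norm (c + (\<alpha> *\<^sub>R x + \<beta> *\<^sub>R c)) = \<rho>"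
proof -
  define y where "y t = (1 - \<bar>t\<bar>) *\<^sub>R x + t *\<^sub>R c" for t
  define f where "f t = norm (c + (1 / norm (y t)) *\<^sub>R y t)" for t
  have y0: "y t \<noteq> 0" for t
    unfolding y_def using indep2_nonzero[OF ind, of "1 - \<bar>t\<bar>" t] by (cases "t = 0") auto
  have "continuous_on {-1..1} f"
    unfolding f_def y_def using y0 by (intro continuous_intros) (auto simp: y_def)
  moreover have "f (-1) = 0" "f 1 = 2"
    using c norm_scaleR[of 2 c] by (simp_all add: f_def y_def scaleR_2)
  ultimately obtain t where t: "-1 \<le> t" "t \<le> 1" "f t = \<rho>"
    using IVT'[of f "-1" \<rho> 1] \<rho> by auto
  have t1: "t \<noteq> 1" "t \<noteq> -1"
    using t(3) \<open>f (-1) = 0\<close> \<open>f 1 = 2\<close> \<rho> by auto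
  show ?thesis
  proof (rule that[of "(1 - \<bar>t\<bar>) / norm (y t)" "t / norm (y t)"])
    show "(1 - \<bar>t\<bar>) / norm (y t) > 0"
      using t t1 y0 by (simp add: divide_pos_pos abs_if)
    have e: "((1 - \<bar>t\<bar>) / norm (y t)) *\<^sub>R x + (t / norm (y t)) *\<^sub>R c = (1 / norm (y t)) *\<^sub>R y t"
      unfolding y_def by (simp add: scaleR_right_distrib)
    show "norm (((1 - \<bar>t\<bar>) / norm (y t)) *\<^sub>R x + (t / norm (y t)) *\<^sub>R c) = 1"
      unfolding e using y0 by simp
    show "norm (c + (((1 - \<bar>t\<bar>) / norm (y t)) *\<^sub>R x + (t / norm (y t)) *\<^sub>R c)) = \<rho>"
      unfolding e using t(3) by (simp add: f_def)
  qed
qed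

section \<open>Strict convexity\<close>

text \<open>The exclusions of equal and of opposite vectors say exactly that \<open>a\<close>,
  \<open>b\<close>, \<open>c\<close> and \<open>a + b + c\<close> are four distinct points, as an
  orthocentric system requires.\<close>

locale bisecting_norm =
  fixes space_type :: "'a::real_normed_vector itself"
  assumes bisect: "\<And>a b c :: 'a. norm a = 1 \<Longrightarrow> norm b = 1 \<Longrightarrow> norm c = 1 \<Longrightarrow>
    a \<noteq> b \<Longrightarrow> a \<noteq> - b \<Longrightarrow> a \<noteq> c \<Longrightarrow> a \<noteq> - c \<Longrightarrow> b \<noteq> c \<Longrightarrow> b \<noteq> - c \<Longrightarrow>
    norm (c - a) = norm (c - b) \<Longrightarrow> \<exists>k. a + b = k *\<^sub>R c"
begin

text \<open>The point \<open>a = c + r e\<close> of a flat is matched with the point \<open>b = \<kappa> c - r e\<close> on the other side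
  of \<open>c\<close> that has the same distance \<open>r\<close> from \<open>c\<close>.\<close>

lemma reflected_point:
  fixes c e :: 'a
  assumes ind: "indep2 c e" and c: "norm c = 1"
    and a: "norm (c + r *\<^sub>R e) = 1" and e: "norm e = 1"
    and r: "0 < r" "r < 2" and far: "norm (2 *\<^sub>R c + r *\<^sub>R e) \<noteq> r"
  obtains \<kappa> where "norm (\<kappa> *\<^sub>R c - r *\<^sub>R e) = 1" "norm ((1 - \<kappa>) *\<^sub>R c + r *\<^sub>R e) = r"
proof -
  have ind': "indep2 e c"
    using indep2_combination[OF ind, of 0 0 1 1] by simp
  \<comment> \<open>The arc point has distance \<open>r\<close> from \<open>- c\<close>, so its
    negative \<open>?b\<close> has distance \<open>r\<close> from \<open>c\<close>, just like
    \<open>?a\<close>, and lies on the other side of the line through 0 and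
    \<open>c\<close>.\<close>
  obtain \<alpha> \<beta> where ab: "\<alpha> > 0" "norm (\<alpha> *\<^sub>R e + \<beta> *\<^sub>R c) = 1" "norm (c + (\<alpha> *\<^sub>R e + \<beta> *\<^sub>R c)) = r"
    using unit_arc_distance[OF ind' c r] by blast
  let ?a = "c + r *\<^sub>R e" and ?b = "- (\<alpha> *\<^sub>R e + \<beta> *\<^sub>R c)"
  note iff = indep2_eq_iff[OF ind]
  have "?a \<noteq> ?b" "?a \<noteq> c" "?a \<noteq> - c" "?b \<noteq> c" "?b \<noteq> - c"
    using iff[of 1 r "-\<beta>" "-\<alpha>"] iff[of 1 r 1 0] iff[of 1 r "-1" 0]
      iff[of "-\<beta>" "-\<alpha>" 1 0] iff[of "-\<beta>" "-\<alpha>" "-1" 0] ab(1) r by (auto simp: algebra_simps)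
  moreover have "?a \<noteq> - ?b"
  proof
    assume "?a = - ?b"
    then have "c + (\<alpha> *\<^sub>R e + \<beta> *\<^sub>R c) = 2 *\<^sub>R c + r *\<^sub>R e"
      by (simp add: scaleR_2)
    then show False using ab(3) far by simp
  qed
  moreover have "norm ?b = 1"
    using ab(2) by (simp only: norm_minus_cancel)
  moreover have "norm (c - ?a) = norm (c - ?b)"
    unfolding diff_minus_eq_add ab(3) using e r by simp
  ultimately obtain k where k: "?a + ?b = k *\<^sub>R c"
    using bisect[of ?a ?b c] a c by blast
  then have "\<alpha> = r"
    using iff[of "1 - \<beta>" "r - \<alpha>" k 0] by (simp add: algebra_simps)
  have "norm (- \<beta> *\<^sub>R c - r *\<^sub>R e) = norm ?b"
    using \<open>\<alpha> = r\<close> by (simp add: algebra_simps)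
  moreover have "norm ((1 - (- \<beta>)) *\<^sub>R c + r *\<^sub>R e) = r"
    using ab(3) \<open>\<alpha> = r\<close> by (simp add: algebra_simps)
  ultimately show ?thesis
    using that[of "- \<beta>"] \<open>norm ?b = 1\<close> by simp
qed

text \<open>Here \<open>c\<close> is an interior point in the first half of a maximal flat. For
  \<open>s < r\<close> and \<open>r < l - s\<close>, the point \<open>c + r e\<close> lies on the
  flat and \<open>c - r e\<close> does not. So the reflected point has \<open>\<kappa> < 1\<close>,
  and dividing its distance identity by \<open>r\<close> gives a unit vector
  \<open>e + \<tau> c\<close> with \<open>\<tau> > 0\<close>. Two values of \<open>r\<close> give
  two values of \<open>\<tau>\<close>; with \<open>e\<close> itself these are three unit vectors on
  a line, so the norm is minimal there.\<close>

lemma flat_direction_minimal: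
  fixes a e :: 'a
  assumes ind: "indep2 a e" and e: "norm e = 1"
    and flat: "\<And>t. norm (a + t *\<^sub>R e) = 1 \<longleftrightarrow> 0 \<le> t \<and> t \<le> l"
    and above: "\<And>t. 1 \<le> norm (a + t *\<^sub>R e)"
    and s: "0 < s" "s < l / 2"
  defines "c \<equiv> a + s *\<^sub>R e"
  shows "(\<exists>\<tau>>0. norm (e + \<tau> *\<^sub>R c) = 1) \<and> (\<forall>\<tau>. 1 \<le> norm (e + \<tau> *\<^sub>R c))"
proof -
  have line: "c + t *\<^sub>R e = a + (s + t) *\<^sub>R e" for t
    by (simp add: c_def algebra_simps)
  have ind_c: "indep2 c e"
    using indep2_combination[OF ind, of 1 1 s 0] by (simp add: c_def)
  have c1: "norm c = 1"
    using flat[of s] s by (simp add: c_def)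
  have above_c: "1 \<le> norm (c + t *\<^sub>R e)" for t
    unfolding line by (rule above)
  \<comment> \<open>The ends of the flat are unit vectors, so they are at most 2 apart; this keeps
    \<open>r\<close> below 2 as \<open>reflected_point\<close> demands.\<close>
  have l2: "l \<le> 2"
  proof -
    have "norm ((a + l *\<^sub>R e) - (a + 0 *\<^sub>R e)) \<le> norm (a + l *\<^sub>R e) + norm (a + 0 *\<^sub>R e)"
      by (rule norm_triangle_ineq4)
    then show ?thesis
      using flat[of l] flat[of 0] s e by simp
  qed
  have above_scaled: "\<bar>x\<bar> \<le> norm (x *\<^sub>R c + y *\<^sub>R e)" for x y
  proof (cases "x = 0")
    case False
    then have "x *\<^sub>R c + y *\<^sub>R e = x *\<^sub>R (c + (y / x) *\<^sub>R e)"
      by (simp add: scaleR_right_distrib)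
    then show ?thesis
      using above_c[of "y / x"] by (simp add: mult_le_cancel_left1)
  qed simp
  have ex: "\<exists>\<tau>>0. norm (e + \<tau> *\<^sub>R c) = 1 \<and> norm (c + r *\<^sub>R (- (\<tau> *\<^sub>R c + e))) = 1"
    if r: "s < r" "r < l - s" for r
  proof -
    have rb: "0 < r" "r < 2" using r s l2 by linarith+
    have far: "norm (2 *\<^sub>R c + r *\<^sub>R e) \<noteq> r"
      using above_scaled[of 2 r] rb by linarith
    have "norm (c + r *\<^sub>R e) = 1"
      unfolding line using flat[of "s + r"] r s by simp
    then obtain \<kappa> where k: "norm (\<kappa> *\<^sub>R c - r *\<^sub>R e) = 1" "norm ((1 - \<kappa>) *\<^sub>R c + r *\<^sub>R e) = r"
      using reflected_point[OF ind_c c1 _ e rb far] by blast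
    have "\<kappa> \<noteq> 1"
    proof
      assume "\<kappa> = 1"
      then have "norm (a + (s - r) *\<^sub>R e) = 1"
        using k(1) line[of "- r"] by simp
      then show False
        using flat[of "s - r"] r by simp
    qed
    moreover have "\<kappa> \<le> 1"
      using above_scaled[of \<kappa> "- r"] k(1) by simp
    ultimately have pos: "(1 - \<kappa>) / r > 0"
      using r s by simp
    have r0: "r \<noteq> 0" using r s by simp
    have "(1 - \<kappa>) *\<^sub>R c + r *\<^sub>R e = r *\<^sub>R (e + ((1 - \<kappa>) / r) *\<^sub>R c)"
      using r0 by (simp add: scaleR_right_distrib add.commute)
    then have "norm (e + ((1 - \<kappa>) / r) *\<^sub>R c) = 1"
      using k(2) r s by simp
    \<comment> \<open>The reflected point lies on a line through \<open>c\<close> that depends on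
      \<open>r\<close> only through \<open>\<tau>\<close>; equal values of \<open>\<tau>\<close>
      would thus put two reflected points on one line.\<close>
    moreover have "c + r *\<^sub>R (- (((1 - \<kappa>) / r) *\<^sub>R c + e)) = \<kappa> *\<^sub>R c - r *\<^sub>R e"
    proof -
      have "c + r *\<^sub>R (- (q *\<^sub>R c + e)) = (1 - r * q) *\<^sub>R c - r *\<^sub>R e" for q
        by (simp add: algebra_simps)
      moreover have "1 - r * ((1 - \<kappa>) / r) = \<kappa>" using r0 by simp
      ultimately show ?thesis by (simp only:)
    qed
    ultimately show ?thesis
      using pos k(1) by (intro exI[of _ "(1 - \<kappa>) / r"]) simp
  qed
  have "s < l - s" using s by simp
  then obtain r1 where r1: "s < r1" "r1 < l - s" using dense by blast
  then obtain r2 where r2: "r1 < r2" "r2 < l - s" using dense by blast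
  note r = r1(1) r2
  obtain \<tau>1 where t1: "\<tau>1 > 0" "norm (e + \<tau>1 *\<^sub>R c) = 1" "norm (c + r1 *\<^sub>R (- (\<tau>1 *\<^sub>R c + e))) = 1"
    using ex[of r1] r by auto
  obtain \<tau>2 where t2: "\<tau>2 > 0" "norm (e + \<tau>2 *\<^sub>R c) = 1" "norm (c + r2 *\<^sub>R (- (\<tau>2 *\<^sub>R c + e))) = 1"
    using ex[of r2] r by auto
  have "\<tau>1 \<noteq> \<tau>2"
  proof
    assume eq: "\<tau>1 = \<tau>2"
    \<comment> \<open>Otherwise the sphere has a second flat through \<open>c\<close>, although \<open>c\<close> is interior to the first.\<close>
    define d where "d = - (\<tau>1 *\<^sub>R c + e)"
    have min: "1 \<le> norm (c + r *\<^sub>R d)" for r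
      using norm_line_flat_minimal[of 0 r1 r2 c d 1 r] r s t1 t2 c1 eq by (simp add: d_def)
    \<comment> \<open>Chosen so that the line from \<open>c\<close> along \<open>d\<close> meets the
      ray of \<open>a\<close> at \<open>\<theta> a\<close>, strictly inside the unit ball.\<close>
    define \<theta> where "\<theta> = 1 / (1 + s * \<tau>1)"
    have pos: "1 + s * \<tau>1 > 1" using s t1 by simp
    then have th: "0 < \<theta>" "\<theta> < 1" "\<theta> + \<theta> * s * \<tau>1 = 1"
      by (auto simp: \<theta>_def field_simps)
    have "c + (\<theta> * s) *\<^sub>R d = (1 - \<theta> * s * \<tau>1) *\<^sub>R c - (\<theta> * s) *\<^sub>R e"
      by (simp add: d_def algebra_simps)
    also have "1 - \<theta> * s * \<tau>1 = \<theta>" using th(3) by simp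
    also have "\<theta> *\<^sub>R c - (\<theta> * s) *\<^sub>R e = \<theta> *\<^sub>R a"
      by (simp add: c_def algebra_simps)
    finally have "norm (c + (\<theta> * s) *\<^sub>R d) = \<theta>"
      using th flat[of 0] s by simp
    then show False using min[of "\<theta> * s"] th by simp
  qed
  then have "1 \<le> norm (e + \<tau> *\<^sub>R c)" for \<tau>
    using norm_line_flat_minimal[of 0 \<tau>1 \<tau>2 e c 1 \<tau>] norm_line_flat_minimal[of 0 \<tau>2 \<tau>1 e c 1 \<tau>]
      t1 t2 e by (cases "\<tau>1 < \<tau>2") auto
  then show ?thesis using t1 by blast
qed

text \<open>Two points \<open>?c1\<close>, \<open>?c2\<close> of the first half of the flat differ
  by a multiple of \<open>e\<close>. Hence the unit vector \<open>e + \<tau> ?c2\<close> is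
  \<open>k > 1\<close> times a vector \<open>e + (\<tau> / k) ?c1\<close>, whose norm is at least
  1.\<close>

lemma no_flat_segment:
  fixes a e :: 'a
  assumes ind: "indep2 a e" and e: "norm e = 1"
    and flat: "\<And>t. norm (a + t *\<^sub>R e) = 1 \<longleftrightarrow> 0 \<le> t \<and> t \<le> l"
    and above: "\<And>t. 1 \<le> norm (a + t *\<^sub>R e)"
  shows "l \<le> 0"
proof (rule ccontr)
  assume "\<not> l \<le> 0"
  then have l: "l > 0" by simp
  let ?c1 = "a + (l / 6) *\<^sub>R e" and ?c2 = "a + (l / 3) *\<^sub>R e"
  have m: "1 \<le> norm (e + \<tau> *\<^sub>R ?c1)" for \<tau>
    using flat_direction_minimal[OF ind e flat above, of "l / 6"] l by simp
  obtain \<tau> where t: "\<tau> > 0" "norm (e + \<tau> *\<^sub>R ?c2) = 1"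
    using flat_direction_minimal[OF ind e flat above, of "l / 3"] l by auto
  define k where "k = 1 + \<tau> * (l / 6)"
  have k: "k > 1" using t l by (simp add: k_def)
  have "?c2 = ?c1 + (l / 6) *\<^sub>R e"
    by (simp flip: scaleR_left_distrib)
  then have "e + \<tau> *\<^sub>R ?c2 = k *\<^sub>R e + \<tau> *\<^sub>R ?c1"
    by (simp add: k_def scaleR_left_distrib scaleR_right_distrib)
  also have "\<dots> = k *\<^sub>R (e + (\<tau> / k) *\<^sub>R ?c1)"
    using k by (simp add: scaleR_right_distrib)
  finally have "1 = k * norm (e + (\<tau> / k) *\<^sub>R ?c1)"
    using t(2) k by simp
  moreover have "k * 1 \<le> k * norm (e + (\<tau> / k) *\<^sub>R ?c1)"
    using m k by (intro mult_left_mono) auto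
  ultimately show False using k by linarith
qed

text \<open>After rescaling to level 1 and a unit direction, three equal values make 1 the minimum
  on the line. The level set is compact, and its extreme parameters \<open>t0\<close>,
  \<open>t1\<close> bound a maximal flat of positive length, contrary to
  \<open>no_flat_segment\<close>.\<close>

lemma strictly_convex_line:
  fixes u v :: 'a
  assumes ind: "indep2 u v" and "x < y" "y < z"
    and eq: "norm (u + x *\<^sub>R v) = \<rho>" "norm (u + y *\<^sub>R v) = \<rho>" "norm (u + z *\<^sub>R v) = \<rho>"
  shows False
proof -
  have \<rho>: "\<rho> > 0"
    using eq(1) indep2_line_nonzero[OF ind, of x] by auto
  have v: "norm v > 0" using indep2_nonzeroD[OF ind] by simp
  define e where "e = (1 / norm v) *\<^sub>R v"
  define w where "w = (1 / \<rho>) *\<^sub>R u"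
  have ew: "norm e = 1" using v by (simp add: e_def)
  define f where "f t = norm (w + t *\<^sub>R e)" for t
  have f_eq: "f (norm v * t / \<rho>) = norm (u + t *\<^sub>R v) / \<rho>" for t
  proof -
    have "w + (norm v * t / \<rho>) *\<^sub>R e = (1 / \<rho>) *\<^sub>R (u + t *\<^sub>R v)"
      using v by (simp add: w_def e_def scaleR_right_distrib)
    then show ?thesis using \<rho> by (simp add: f_def)
  qed
  define k where "k = norm v / \<rho>"
  have k: "k > 0" using v \<rho> by (simp add: k_def)
  have f1: "f (k * x) = 1" "f (k * y) = 1" "f (k * z) = 1"
    using f_eq[of x] f_eq[of y] f_eq[of z] eq \<rho> by (simp_all add: k_def)
  have lt: "k * x < k * y" "k * y < k * z"
    using k assms by simp_all
  have above: "1 \<le> f t" for t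
    using norm_line_flat_minimal[OF lt, of w e 1 t] f1 by (simp add: f_def)
  define S where "S = {t. f t = 1}"
  have cont: "continuous_on UNIV f"
    unfolding f_def by (intro continuous_intros)
  have "closed S"
    unfolding S_def using cont by (intro closed_Collect_eq) auto
  moreover have "bounded S"
  proof (rule boundedI)
    fix t assume "t \<in> S"
    then show "norm t \<le> 1 + norm w"
      using norm_line_lower_bound[OF ew, of t w] by (simp add: S_def f_def)
  qed
  ultimately have cS: "compact S" by (simp add: compact_eq_bounded_closed)
  have ne: "S \<noteq> {}" using f1 by (auto simp: S_def)
  obtain t0 where t0: "t0 \<in> S" "\<forall>t\<in>S. t0 \<le> t" using compact_attains_inf[OF cS ne] by blast
  obtain t1 where t1: "t1 \<in> S" "\<forall>t\<in>S. t \<le> t1" using compact_attains_sup[OF cS ne] by blast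
  have t01: "t0 < t1"
  proof -
    have "t0 \<le> k * x" "k * y \<le> t1" using t0(2) t1(2) f1 by (simp_all add: S_def)
    then show ?thesis using lt(1) by linarith
  qed
  have "f t = 1" if t: "t0 \<le> t" "t \<le> t1" for t
  proof -
    have "(t1 - t0) * f t \<le> (t1 - t) * f t0 + (t - t0) * f t1"
      unfolding f_def using norm_line_convex[OF t] .
    also have "\<dots> = (t1 - t0) * 1" using t0 t1 by (simp add: S_def)
    finally have "f t \<le> 1" using t01 by simp
    then show ?thesis using above[of t] by simp
  qed
  then have S_iff: "f t = 1 \<longleftrightarrow> t0 \<le> t \<and> t \<le> t1" for t
    using t0(2) t1(2) unfolding S_def by blast
  have sh: "(w + t0 *\<^sub>R e) + t *\<^sub>R e = w + (t0 + t) *\<^sub>R e" for t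
    by (simp add: algebra_simps)
  have "indep2 (w + t0 *\<^sub>R e) e"
    using indep2_combination[OF ind, of "1 / \<rho>" "1 / norm v" "t0 / norm v" 0] v \<rho>
    by (simp add: w_def e_def)
  then have "t1 - t0 \<le> 0"
  proof (rule no_flat_segment[OF _ ew])
    show "norm ((w + t0 *\<^sub>R e) + t *\<^sub>R e) = 1 \<longleftrightarrow> 0 \<le> t \<and> t \<le> t1 - t0" for t
      unfolding sh using S_iff[of "t0 + t"] by (auto simp: f_def)
    show "1 \<le> norm ((w + t0 *\<^sub>R e) + t *\<^sub>R e)" for t
      unfolding sh using above[of "t0 + t"] by (simp add: f_def)
  qed
  then show False using t01 by simp
qed

lemma strictly_convex_level:
  fixes u v :: 'a
  assumes ind: "indep2 u v" and "x < y"
    and eq: "norm (u + x *\<^sub>R v) = norm (u + y *\<^sub>R v)"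
  shows "x < z \<Longrightarrow> z < y \<Longrightarrow> norm (u + z *\<^sub>R v) < norm (u + x *\<^sub>R v)"
    and "z < x \<or> y < z \<Longrightarrow> norm (u + x *\<^sub>R v) < norm (u + z *\<^sub>R v)"
proof -
  assume z: "x < z" "z < y"
  have "(y - x) * norm (u + z *\<^sub>R v) \<le> (y - x) * norm (u + x *\<^sub>R v)"
    using norm_line_convex[of x z y u v] z eq by (simp add: algebra_simps)
  then have "norm (u + z *\<^sub>R v) \<le> norm (u + x *\<^sub>R v)"
    using assms by simp
  then show "norm (u + z *\<^sub>R v) < norm (u + x *\<^sub>R v)"
    using strictly_convex_line[OF ind z] eq by fastforce
next
  assume z: "z < x \<or> y < z"
  have "norm (u + x *\<^sub>R v) \<le> norm (u + z *\<^sub>R v)"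
    using z
  proof
    assume "z < x"
    then have "(y - x) * norm (u + x *\<^sub>R v) \<le> (y - x) * norm (u + z *\<^sub>R v)"
      using norm_line_convex[of z x y u v] assms by (simp add: algebra_simps)
    then show ?thesis using assms by simp
  next
    assume "y < z"
    then have "(y - x) * norm (u + x *\<^sub>R v) \<le> (y - x) * norm (u + z *\<^sub>R v)"
      using norm_line_convex[of x y z u v] assms by (simp add: algebra_simps)
    then show ?thesis using assms by simp
  qed
  then show "norm (u + x *\<^sub>R v) < norm (u + z *\<^sub>R v)"
    using strictly_convex_line[OF ind, of z x y] strictly_convex_line[OF ind, of x y z] z assms
    by fastforce
qed

section \<open>Symmetry of the norm along lines\<close>

text \<open>The half circle through \<open>a\<close> contains a point
  \<open>\<alpha> a + \<beta> c\<close> at distance \<open>norm (c - a)\<close> from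
  \<open>- c\<close>; its negative \<open>?b\<close> is as far from \<open>c\<close> as
  \<open>a\<close> is. If \<open>a = - ?b\<close>, then \<open>\<alpha> = 1\<close> at once;
  otherwise \<open>a + ?b\<close> is a multiple of \<open>c\<close>, which gives
  \<open>\<alpha> = 1\<close> again.\<close>

lemma partner_on_line:
  fixes a c :: 'a
  assumes ind: "indep2 a c" and a: "norm a = 1" and c: "norm c = 1"
  obtains \<beta> where "norm (a + \<beta> *\<^sub>R c) = 1" "norm (a + (\<beta> + 1) *\<^sub>R c) = norm (a + (- 1) *\<^sub>R c)"
proof -
  have ne: "c \<noteq> a"
    using indep2_eq_iff[OF ind, of 0 1 1 0] by auto
  have "norm (c - a) < 2"
  proof (rule ccontr)
    \<comment> \<open>At distance 2 the midpoint of \<open>c\<close> and \<open>- a\<close> would be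
      a third unit vector on their line.\<close>
    assume "\<not> norm (c - a) < 2"
    then have "norm (c - a) = 2"
      using norm_triangle_ineq4[of c a] a c by simp
    moreover have "c + (1 / 2) *\<^sub>R (- (a + c)) = (1 / 2) *\<^sub>R (c - a)"
      by (simp add: algebra_simps flip: scaleR_add_left)
    ultimately have "norm (c + (1 / 2) *\<^sub>R (- (a + c))) = 1" by simp
    moreover have "indep2 c (- (a + c))"
      using indep2_combination[OF ind, of 0 "-1" 1 "-1"] by simp
    ultimately show False
      using strictly_convex_line[of c "- (a + c)" 0 "1 / 2" 1 1] a c by simp
  qed
  moreover have "0 < norm (c - a)" using ne by simp
  ultimately obtain \<alpha> \<beta> where ab: "\<alpha> > 0" "norm (\<alpha> *\<^sub>R a + \<beta> *\<^sub>R c) = 1"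
    "norm (c + (\<alpha> *\<^sub>R a + \<beta> *\<^sub>R c)) = norm (c - a)"
    using unit_arc_distance[OF ind c] by blast
  let ?b = "- (\<alpha> *\<^sub>R a + \<beta> *\<^sub>R c)"
  note iff = indep2_eq_iff[OF ind]
  have "\<alpha> = 1"
  proof (cases "a = - ?b")
    case True
    then show ?thesis using iff[of 1 0 \<alpha> \<beta>] by (simp only: minus_minus) simp
  next
    case False
    have "a \<noteq> ?b" "a \<noteq> - c" "?b \<noteq> c" "?b \<noteq> - c"
      using iff[of 1 0 "-\<alpha>" "-\<beta>"] iff[of 1 0 0 "-1"]
        iff[of "-\<alpha>" "-\<beta>" 0 1] iff[of "-\<alpha>" "-\<beta>" 0 "-1"] ab(1) by (auto simp: algebra_simps)
    moreover have "norm ?b = 1"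
      using ab(2) by (simp only: norm_minus_cancel)
    moreover have "norm (c - a) = norm (c - ?b)"
      unfolding diff_minus_eq_add ab(3) by simp
    ultimately obtain k where "a + ?b = k *\<^sub>R c"
      using bisect[of a ?b c] a c False ne by blast
    then show ?thesis
      using iff[of "1 - \<alpha>" "- \<beta>" 0 k] by (simp add: algebra_simps)
  qed
  show ?thesis
  proof (rule that[of \<beta>])
    show "norm (a + \<beta> *\<^sub>R c) = 1" using ab(2) \<open>\<alpha> = 1\<close> by simp
    have "a + (\<beta> + 1) *\<^sub>R c = c + (\<alpha> *\<^sub>R a + \<beta> *\<^sub>R c)"
      using \<open>\<alpha> = 1\<close> by (simp add: algebra_simps)
    then show "norm (a + (\<beta> + 1) *\<^sub>R c) = norm (a + (- 1) *\<^sub>R c)"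
      using ab(3) by (simp add: norm_minus_commute)
  qed
qed

text \<open>By strict convexity the partner of one end of the chord is that end or the other one. In
  the second case the claim follows at once. So it remains to exclude that \<open>a\<close> is its
  own partner, and for this the partner of the other end is examined too.\<close>

lemma unit_chord_extension:
  fixes a c :: 'a
  assumes ind: "indep2 a c" and c: "norm c = 1" and \<mu>: "\<mu> > 0"
    and a: "norm a = 1" "norm (a + \<mu> *\<^sub>R c) = 1"
  shows "norm (a + (- 1) *\<^sub>R c) = norm (a + (\<mu> + 1) *\<^sub>R c)"
proof -
  define g where "g t = norm (a + t *\<^sub>R c)" for t
  note level = strictly_convex_level[OF ind, folded g_def]
  have g0: "g 0 = 1" "g \<mu> = 1" using a by (simp_all add: g_def)
  have on_chord: "t = 0 \<or> t = \<mu>" if "g t = 1" for t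
    using level[OF \<mu>, of t] g0 that by fastforce
  obtain \<beta> where b: "g \<beta> = 1" "g (\<beta> + 1) = g (- 1)"
    using partner_on_line[OF ind a(1) c] by (auto simp: g_def)
  have ind': "indep2 (a + \<mu> *\<^sub>R c) c"
    using indep2_combination[OF ind, of 1 1 \<mu> 0] by simp
  have sh: "norm (a + \<mu> *\<^sub>R c + t *\<^sub>R c) = g (\<mu> + t)" for t
    by (simp add: g_def algebra_simps)
  obtain \<gamma> where b': "g (\<mu> + \<gamma>) = 1" "g (\<mu> + (\<gamma> + 1)) = g (\<mu> - 1)"
    using partner_on_line[OF ind' a(2) c, unfolded sh] by auto
  have "g (-1) = g (\<mu> + 1)"
  proof (rule ccontr)
    assume neq: "g (-1) \<noteq> g (\<mu> + 1)"
    then have g1: "g (-1) = g 1"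
      using on_chord[OF b(1)] b(2) by auto
    from on_chord[OF b'(1)] show False
    proof
      \<comment> \<open>Both ends are their own partners: the chords over \<open>[-1, 1]\<close> and
        \<open>[\<mu> - 1, \<mu> + 1]\<close> are shifts of each other, so each has an end strictly
        outside the other.\<close>
      assume "\<mu> + \<gamma> = \<mu>"
      then have "g (\<mu> - 1) = g (\<mu> + 1)" using b'(2) by simp
      then have "g (\<mu> - 1) < g (-1)" "g (-1) < g (\<mu> + 1)"
        using level(2)[of "\<mu> - 1" "\<mu> + 1" "-1"] level(2)[of "-1" 1 "\<mu> + 1"] g1 \<mu> by auto
      then show False using \<open>g (\<mu> - 1) = g (\<mu> + 1)\<close> by simp
    next
      \<comment> \<open>Now \<open>\<mu> - 1\<close> shares the level of -1 and 1, so
        \<open>\<mu> = 2\<close>. Then 1 lies inside the chord and -1 outside, although their values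
        agree.\<close>
      assume "\<mu> + \<gamma> = 0"
      then have "g (\<mu> - 1) = g 1" using b'(2) by (simp add: add.assoc[symmetric])
      then have "\<mu> - 1 = 1"
        using level[of "-1" 1 "\<mu> - 1"] g1 \<mu> by fastforce
      then have "g 1 < 1" "1 < g (-1)"
        using level(1)[of 0 \<mu> 1] level(2)[of 0 \<mu> "-1"] g0 by auto
      then show False using g1 by simp
    qed
  qed
  then show ?thesis by (simp add: g_def)
qed

text \<open>Division by \<open>\<rho>\<close> turns the chord into one of unit vectors, where a step
  of length 1 corresponds to a step of length \<open>\<rho>\<close> on the original line.\<close>

lemma chord_extension:
  fixes u c :: 'a
  assumes ind: "indep2 u c" and c: "norm c = 1" and "s < t"
    and eq: "norm (u + s *\<^sub>R c) = \<rho>" "norm (u + t *\<^sub>R c) = \<rho>"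
  shows "norm (u + (s - \<rho>) *\<^sub>R c) = norm (u + (t + \<rho>) *\<^sub>R c)"
proof -
  have \<rho>: "\<rho> > 0" using eq(1) indep2_line_nonzero[OF ind, of s] by auto
  define a where "a = (1 / \<rho>) *\<^sub>R (u + s *\<^sub>R c)"
  have sc: "a + x *\<^sub>R c = (1 / \<rho>) *\<^sub>R (u + (s + \<rho> * x) *\<^sub>R c)" for x
    using \<rho> by (simp add: a_def scaleR_right_distrib scaleR_left_distrib)
  have ind': "indep2 a c"
    using indep2_combination[OF ind, of "1 / \<rho>" 1 "s / \<rho>" 0] \<rho>
    by (simp add: a_def scaleR_right_distrib)
  have "norm a = 1" using eq(1) \<rho> by (simp add: a_def)
  moreover have "norm (a + ((t - s) / \<rho>) *\<^sub>R c) = 1"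
    unfolding sc using eq(2) \<rho> by simp
  ultimately have "norm (a + (- 1) *\<^sub>R c) = norm (a + ((t - s) / \<rho> + 1) *\<^sub>R c)"
    using unit_chord_extension[OF ind' c] \<rho> \<open>s < t\<close> by simp
  moreover have "s + \<rho> * ((t - s) / \<rho> + 1) = t + \<rho>"
    using \<rho> by (simp add: field_simps)
  ultimately show ?thesis
    unfolding sc using \<rho> by simp
qed

text \<open>Each extension keeps the midpoint and lengthens the half-chord by the level at its ends.
  These lie at or beyond the ends of the original chord, so every gain is at least
  \<open>\<rho>\<close>.\<close>

lemma large_chords:
  fixes u c :: 'a
  assumes ind: "indep2 u c" and c: "norm c = 1" and h: "h > 0"
    and eq: "norm (u + (m + h) *\<^sub>R c) = norm (u + (m - h) *\<^sub>R c)"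
  shows "\<exists>k\<ge>T. norm (u + (m + k) *\<^sub>R c) = norm (u + (m - k) *\<^sub>R c)"
proof -
  define g where "g t = norm (u + t *\<^sub>R c)" for t
  define \<rho> where "\<rho> = g (m + h)"
  have \<rho>: "\<rho> > 0" using indep2_line_nonzero[OF ind] by (simp add: \<rho>_def g_def)
  have eqg: "g (m + h) = g (m - h)" using eq by (simp add: g_def)
  have ex: "\<exists>k\<ge>h + real n * \<rho>. g (m + k) = g (m - k)" for n
  proof (induction n)
    case 0
    then show ?case using eqg by auto
  next
    case (Suc n)
    then obtain k where k: "k \<ge> h + real n * \<rho>" "g (m + k) = g (m - k)" by blast
    have "k \<ge> h" using k(1) \<rho> by (smt (verit) mult_nonneg_nonneg of_nat_0_le_iff)
    have "g (m - h) \<le> g (m + k)"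
      using strictly_convex_level(2)[OF ind, of "m - h" "m + h" "m + k", folded g_def] \<open>k \<ge> h\<close> h eqg
      by (cases "k = h") auto
    then have "k + g (m + k) \<ge> h + real (Suc n) * \<rho>"
      using k(1) eqg by (simp add: \<rho>_def algebra_simps)
    moreover have "g (m + (k + g (m + k))) = g (m - (k + g (m + k)))"
      using chord_extension[OF ind c, of "m - k" "m + k" "g (m + k)"] k(2) h \<open>k \<ge> h\<close>
      by (simp add: g_def algebra_simps)
    ultimately show ?case by blast
  qed
  obtain n where "(T - h) / \<rho> \<le> real n" using real_arch_simple by blast
  then have "T \<le> h + real n * \<rho>" using \<rho> by (simp add: field_simps)
  then show ?thesis using ex[of n] by (auto simp: g_def intro: order_trans)
qed

lemma chord_midpoint_unique:
  fixes u c :: 'a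
  assumes ind: "indep2 u c" and c: "norm c = 1" and "s < t" "s' < t'"
    and "norm (u + s *\<^sub>R c) = norm (u + t *\<^sub>R c)"
    and "norm (u + s' *\<^sub>R c) = norm (u + t' *\<^sub>R c)"
  shows "s + t = s' + t'"
proof -
  have "(s + t) / 2 = (s' + t') / 2"
  proof (rule asymptotic_midpoint_unique[OF c])
    have "(s + t) / 2 + (t - s) / 2 = t" "(s + t) / 2 - (t - s) / 2 = s" by (simp_all add: field_simps)
    then show "\<exists>h\<ge>T. norm (u + ((s + t) / 2 + h) *\<^sub>R c) = norm (u + ((s + t) / 2 - h) *\<^sub>R c)" for T
      using large_chords[OF ind c, of "(t - s) / 2" "(s + t) / 2"] assms by simp
    have "(s' + t') / 2 + (t' - s') / 2 = t'" "(s' + t') / 2 - (t' - s') / 2 = s'" by (simp_all add: field_simps)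
    then show "\<exists>h\<ge>T. norm (u + ((s' + t') / 2 + h) *\<^sub>R c) = norm (u + ((s' + t') / 2 - h) *\<^sub>R c)" for T
      using large_chords[OF ind c, of "(t' - s') / 2" "(s' + t') / 2"] assms by simp
  qed
  then show ?thesis by simp
qed

text \<open>The given chord places all chord midpoints at 0. If the value at \<open>- t\<close> were
  smaller than at \<open>t\<close>, the value at \<open>t\<close> would be attained again at
  distance \<open>x \<ge> \<bar>t\<bar>\<close> on the opposite side; the midpoint then forces
  \<open>x = \<bar>t\<bar>\<close>, a contradiction. The reverse inequality is the case of
  \<open>- t\<close>.\<close>

lemma symmetric_line_le:
  fixes u c :: 'a
  assumes ind: "indep2 u c" and c: "norm c = 1" and "r \<noteq> 0"
    and eq: "norm (u + r *\<^sub>R c) = norm (u - r *\<^sub>R c)"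
  shows "norm (u + t *\<^sub>R c) \<le> norm (u - t *\<^sub>R c)"
proof (rule ccontr)
  assume "\<not> norm (u + t *\<^sub>R c) \<le> norm (u - t *\<^sub>R c)"
  then have less: "norm (u - t *\<^sub>R c) < norm (u + t *\<^sub>R c)" by simp
  define d where "d = sgn t *\<^sub>R c"
  have t: "t \<noteq> 0" using less by auto
  have d: "norm d = 1" using t c by (simp add: d_def norm_sgn)
  have ud: "indep2 u d"
    using indep2_combination[OF ind, of 1 "sgn t" 0 0] t by (simp add: d_def sgn_eq_0_iff)
  have td: "t *\<^sub>R c = \<bar>t\<bar> *\<^sub>R d" by (simp add: d_def abs_mult_sgn)
  have rd: "norm (u + (- \<bar>r\<bar>) *\<^sub>R d) = norm (u + \<bar>r\<bar> *\<^sub>R d)"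
  proof -
    have "d = c \<or> d = - c" using t by (simp add: d_def sgn_if)
    then have "\<bar>r\<bar> *\<^sub>R d = r *\<^sub>R c \<or> \<bar>r\<bar> *\<^sub>R d = - (r *\<^sub>R c)"
      by (cases "r \<ge> 0") auto
    then show ?thesis using eq by (elim disjE) simp_all
  qed
  let ?f = "\<lambda>x. norm (u + x *\<^sub>R (- d))"
  \<comment> \<open>Large enough for \<open>norm_line_lower_bound\<close> to lift the norm at
    \<open>T\<close> above the target value.\<close>
  define T where "T = \<bar>t\<bar> + norm u + norm (u + t *\<^sub>R c)"
  have "T - norm u \<le> ?f T"
    using norm_line_lower_bound[of "- d" T u] d by (simp add: T_def)
  then have "norm (u + t *\<^sub>R c) \<le> ?f T" by (simp add: T_def)
  moreover have "?f \<bar>t\<bar> \<le> norm (u + t *\<^sub>R c)" using less td by simp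
  ultimately obtain x where x: "\<bar>t\<bar> \<le> x" "?f x = norm (u + t *\<^sub>R c)"
    using IVT'[of ?f "\<bar>t\<bar>" "norm (u + t *\<^sub>R c)" T] continuous_on_norm_line[of _ u "- d"]
    by (auto simp: T_def)
  have "- x + \<bar>t\<bar> = - \<bar>r\<bar> + \<bar>r\<bar>"
    using chord_midpoint_unique[OF ud d, of "- x" "\<bar>t\<bar>" "- \<bar>r\<bar>" "\<bar>r\<bar>"] x td rd t \<open>r \<noteq> 0\<close> by simp
  then show False using x(2) less td by simp
qed

lemma isosceles_homogeneous:
  fixes u v :: 'a
  assumes ind: "indep2 u v" and eq: "norm (u + v) = norm (u - v)"
  shows "norm (p *\<^sub>R u + q *\<^sub>R v) = norm (p *\<^sub>R u - q *\<^sub>R v)"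
proof (cases "p = 0")
  case False
  have v: "norm v > 0" using indep2_nonzeroD[OF ind] by simp
  define c where "c = (1 / norm v) *\<^sub>R v"
  have c: "norm c = 1" using v by (simp add: c_def)
  have vc: "t *\<^sub>R v = (t * norm v) *\<^sub>R c" for t using v by (simp add: c_def)
  have uc: "indep2 u c"
    using indep2_combination[OF ind, of 1 "1 / norm v" 0 0] v by (simp add: c_def)
  have le: "norm (u + t *\<^sub>R c) \<le> norm (u - t *\<^sub>R c)" for t
    using symmetric_line_le[OF uc c, of "norm v" t] v eq vc[of 1] by simp
  have "norm (u + (q / p) *\<^sub>R v) = norm (u - (q / p) *\<^sub>R v)"
    unfolding vc using le[of "q / p * norm v"] le[of "- (q / p * norm v)"] by simp
  then have "\<bar>p\<bar> * norm (u + (q / p) *\<^sub>R v) = \<bar>p\<bar> * norm (u - (q / p) *\<^sub>R v)" by simp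
  then show ?thesis
    using False by (simp add: scaleR_right_distrib scaleR_right_diff_distrib flip: norm_scaleR)
qed simp

end

section \<open>Recovering the inner product\<close>

lemma inner_product_of_coordinates:
  fixes c d :: "'a::real_normed_vector"
  assumes dim: "dim (UNIV :: 'a set) = 2" and ind: "indep2 c d"
    and N: "\<And>p q. norm (p *\<^sub>R c + q *\<^sub>R d) = sqrt (p\<^sup>2 + q\<^sup>2)"
  shows "euclidean_norm TYPE('a)"
proof -
  have "\<forall>x. \<exists>p q. x = p *\<^sub>R c + q *\<^sub>R d"
    using plane_coordinates[OF dim ind] by metis
  then obtain f g where fg: "\<And>x. x = f x *\<^sub>R c + g x *\<^sub>R d" by metis
  have coords: "f (p *\<^sub>R c + q *\<^sub>R d) = p" "g (p *\<^sub>R c + q *\<^sub>R d) = q" for p q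
    using fg[of "p *\<^sub>R c + q *\<^sub>R d"] indep2_eq_iff[OF ind] by metis+
  have add: "f (x + y) = f x + f y" "g (x + y) = g x + g y" for x y
  proof -
    have "x + y = (f x + f y) *\<^sub>R c + (g x + g y) *\<^sub>R d"
      using fg[of x] fg[of y] by (simp add: algebra_simps)
    then show "f (x + y) = f x + f y" "g (x + y) = g x + g y" using coords by metis+
  qed
  have scale: "f (k *\<^sub>R x) = k * f x" "g (k *\<^sub>R x) = k * g x" for k x
  proof -
    have "k *\<^sub>R x = (k * f x) *\<^sub>R c + (k * g x) *\<^sub>R d"
      using fg[of x] by (metis scaleR_right_distrib scaleR_scaleR)
    then show "f (k *\<^sub>R x) = k * f x" "g (k *\<^sub>R x) = k * g x" using coords by metis+
  qed
  define B where "B x y = f x * f y + g x * g y" for x y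
  have norm_B: "norm x = sqrt (B x x)" for x
    using N[of "f x" "g x"] fg[of x] by (simp add: B_def power2_eq_square)
  have "bilinear B"
    unfolding bilinear_def B_def
    by (auto intro!: linearI simp: add scale algebra_simps)
  moreover have "B x x > 0" if "x \<noteq> 0" for x
    using norm_B[of x] that by (metis norm_eq_zero real_sqrt_gt_0_iff zero_less_norm_iff)
  ultimately have "inner_product_form B"
    unfolding inner_product_form_def by (simp add: B_def mult.commute)
  then show ?thesis
    unfolding euclidean_norm_def using norm_B by blast
qed

text \<open>In complex notation the hypothesis gives \<open>N (x z) = N (x (cnj z))\<close> for all \<open>x\<close> and \<open>z\<close>; for
  \<open>x = z\<close> a square root of a unit complex number \<open>w\<close> this reads \<open>N w = N 1\<close>.\<close>

lemma euclidean_if_isosceles_homogeneous: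
  assumes dim: "dim (UNIV :: 'a::real_normed_vector set) = 2"
    and iso: "\<And>(u::'a) v p q. indep2 u v \<Longrightarrow> norm (u + v) = norm (u - v) \<Longrightarrow>
      norm (p *\<^sub>R u + q *\<^sub>R v) = norm (p *\<^sub>R u - q *\<^sub>R v)"
  shows "euclidean_norm TYPE('a)"
proof -
  obtain e f :: 'a where ef: "indep2 e f" using plane_basis[OF dim] by blast
  have ne: "norm e > 0" "norm f > 0" using indep2_nonzeroD[OF ef] by simp_all
  define a where "a = (1 / norm e) *\<^sub>R e"
  define b where "b = (1 / norm f) *\<^sub>R f"
  have ab: "indep2 a b"
    using indep2_combination[OF ef, of "1 / norm e" "1 / norm f" 0 0] ne by (simp add: a_def b_def)
  have unit: "norm a = 1" "norm b = 1" using ne by (simp_all add: a_def b_def)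
  \<comment> \<open>The sum and difference of two unit vectors are isosceles orthogonal, since
    \<open>(a + b) + (a - b)\<close> and \<open>(a + b) - (a - b)\<close> are \<open>2 a\<close> and
    \<open>2 b\<close>. Normalised, they serve as axes for which the norm is even in the second
    coordinate.\<close>
  have ab': "indep2 (a + b) (a - b)"
    using indep2_combination[OF ab, of 1 "-1" 1 1] by simp
  have "norm ((a + b) + (a - b)) = norm ((a + b) - (a - b))"
    using unit norm_scaleR[of 2 a] norm_scaleR[of 2 b] by (simp add: scaleR_2 del: norm_scaleR)
  note even' = iso[OF ab' this]
  have ne': "norm (a + b) > 0" "norm (a - b) > 0" using indep2_nonzeroD[OF ab'] by simp_all
  define c where "c = (1 / norm (a + b)) *\<^sub>R (a + b)"
  define d where "d = (1 / norm (a - b)) *\<^sub>R (a - b)"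
  have cd: "indep2 c d"
    using indep2_combination[OF ab', of "1 / norm (a + b)" "1 / norm (a - b)" 0 0] ne'
    by (simp add: c_def d_def)
  have unit': "norm c = 1" "norm d = 1" using ne' by (simp_all add: c_def d_def)
  define N where "N p q = norm (p *\<^sub>R c + q *\<^sub>R d)" for p q
  have scale: "N (k * p) (k * q) = \<bar>k\<bar> * N p q" for k p q
    unfolding N_def by (simp add: scaleR_right_distrib flip: norm_scaleR)
  have even: "N p (- q) = N p q" for p q
    using even'[of "p / norm (a + b)" "q / norm (a - b)"] by (simp add: N_def c_def d_def)
  have minus: "N (- p) (- q) = N p q" for p q
    using scale[of "-1" p q] by simp
  have swap: "N p q = N q p" for p q
  proof -
    \<comment> \<open>The same device for the unit vectors \<open>c\<close> and \<open>d\<close>: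
      the reflection fixing \<open>c + d\<close> and negating \<open>c - d\<close> exchanges the
      coordinates.\<close>
    have "indep2 (c + d) (c - d)"
      using indep2_combination[OF cd, of 1 "-1" 1 1] by simp
    moreover have "norm ((c + d) + (c - d)) = norm ((c + d) - (c - d))"
      using unit' norm_scaleR[of 2 c] norm_scaleR[of 2 d] by (simp add: scaleR_2 del: norm_scaleR)
    ultimately have "norm (((p + q) / 2) *\<^sub>R (c + d) + ((p - q) / 2) *\<^sub>R (c - d)) =
        norm (((p + q) / 2) *\<^sub>R (c + d) - ((p - q) / 2) *\<^sub>R (c - d))"
      by (rule iso)
    moreover have "((p + q) / 2) *\<^sub>R (c + d) + ((p - q) / 2) *\<^sub>R (c - d) =
        ((p + q) / 2 + (p - q) / 2) *\<^sub>R c + ((p + q) / 2 - (p - q) / 2) *\<^sub>R d"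
      "((p + q) / 2) *\<^sub>R (c + d) - ((p - q) / 2) *\<^sub>R (c - d) =
        ((p + q) / 2 - (p - q) / 2) *\<^sub>R c + ((p + q) / 2 + (p - q) / 2) *\<^sub>R d"
      by (simp_all only: scaleR_right_distrib scaleR_right_diff_distrib scaleR_left_distrib
          scaleR_left_diff_distrib) (simp_all only: algebra_simps)
    moreover have "(p + q) / 2 + (p - q) / 2 = p" "(p + q) / 2 - (p - q) / 2 = q"
      by (simp_all add: field_simps)
    ultimately show ?thesis by (simp only: N_def)
  qed
  have circle: "N (p\<^sup>2 - q\<^sup>2) (2 * p * q) = p\<^sup>2 + q\<^sup>2" for p q
  proof (cases "p\<^sup>2 + q\<^sup>2 = 0")
    case True
    then show ?thesis by (simp add: sum_power2_eq_zero_iff N_def)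
  next
    case False
    \<comment> \<open>In complex notation \<open>?x\<close> is \<open>z\<close> and
      \<open>?y\<close> is \<open>i z\<close>, so \<open>p ?x + q ?y\<close> is the square of
      \<open>z\<close> and \<open>p ?x - q ?y\<close> is \<open>z\<close> times its
      conjugate.\<close>
    let ?x = "p *\<^sub>R c + q *\<^sub>R d" and ?y = "(- q) *\<^sub>R c + p *\<^sub>R d"
    have "indep2 ?x ?y"
      using indep2_combination[OF cd, of p p q "- q"] False by (simp add: power2_eq_square)
    moreover have "norm (?x + ?y) = norm (?x - ?y)"
    proof -
      have "?x + ?y = (p - q) *\<^sub>R c + (p + q) *\<^sub>R d" "?x - ?y = (p + q) *\<^sub>R c + (- (p - q)) *\<^sub>R d"
        by (simp_all add: algebra_simps)
      then show ?thesis
        using swap[of "p - q" "p + q"] even[of "p + q" "p - q"] by (simp only: N_def)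
    qed
    ultimately have "norm (p *\<^sub>R ?x + q *\<^sub>R ?y) = norm (p *\<^sub>R ?x - q *\<^sub>R ?y)"
      by (rule iso)
    moreover have "(2 * p * q) *\<^sub>R d = (p * q) *\<^sub>R d + (p * q) *\<^sub>R d"
      by (simp flip: scaleR_left_distrib)
    then have "p *\<^sub>R ?x + q *\<^sub>R ?y = (p\<^sup>2 - q\<^sup>2) *\<^sub>R c + (2 * p * q) *\<^sub>R d"
      "p *\<^sub>R ?x - q *\<^sub>R ?y = (p\<^sup>2 + q\<^sup>2) *\<^sub>R c + 0 *\<^sub>R d"
      by (simp_all only:) (simp_all add: algebra_simps power2_eq_square)
    ultimately have "N (p\<^sup>2 - q\<^sup>2) (2 * p * q) = norm ((p\<^sup>2 + q\<^sup>2) *\<^sub>R c)"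
      by (simp add: N_def)
    then show ?thesis using unit' by simp
  qed
  have "N p q = sqrt (p\<^sup>2 + q\<^sup>2)" for p q
  proof -
    obtain w where w: "w\<^sup>2 = Complex p q"
      using power2_csqrt by blast
    then have "p = (Re w)\<^sup>2 - (Im w)\<^sup>2" "q = 2 * Re w * Im w"
      by (metis Re_power2 complex.sel(1), metis Im_power2 complex.sel(2))
    then have "N p q = (Re w)\<^sup>2 + (Im w)\<^sup>2" using circle by metis
    also have "\<dots> = (cmod w)\<^sup>2" by (simp add: cmod_power2)
    also have "\<dots> = cmod (Complex p q)" by (simp add: norm_power flip: w)
    finally show ?thesis by (simp add: cmod_def)
  qed
  then show ?thesis
    using inner_product_of_coordinates[OF dim cd] by (simp add: N_def)
qed

section \<open>Orthocentric systems\<close>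

text \<open>Half the sum of the four points does not depend on the labeling, which the definition
  leaves open. In the labeling provided it is \<open>a + b + c - x\<close>; subtracting two distinct
  points of the system leaves, up to sign, the difference of \<open>x\<close> and one of
  \<open>a\<close>, \<open>b\<close>, \<open>c\<close>, whose norm is the circumradius.\<close>

lemma orthocentric_system_norms:
  fixes p1 p2 p3 p4 :: "'a::real_normed_vector"
  assumes "C_orthocentric_system {p1, p2, p3, p4}"
  defines "z \<equiv> (1 / 2) *\<^sub>R (p1 + p2 + p3 + p4)"
  shows "distinct [p1, p2, p3, p4]" "norm (z - p1 - p3) = norm (z - p2 - p3)"
proof -
  let ?P = "{p1, p2, p3, p4}"
  have card4: "card ?P = 4"
    using assms(1) by (simp add: C_orthocentric_system_def)
  obtain a b c d x where abcd: "?P = {a, b, c, d}" "x \<in> circumcenters a b c"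
    "d = C_orthocenter a b c x"
    using assms(1) by (auto simp: C_orthocentric_system_def)
  have dist: "distinct [p, q, r, s]" if "card {p, q, r, s} = 4" for p q r s :: 'a
  proof -
    have "card (set [p, q, r, s]) = length [p, q, r, s]" using that by simp
    then show ?thesis by (rule card_distinct)
  qed
  show dp: "distinct [p1, p2, p3, p4]" using dist[OF card4] .
  have da: "distinct [a, b, c, d]" using dist[OF card4[unfolded abcd(1)]] .
  have "\<Sum>?P = \<Sum>{a, b, c, d}" using abcd(1) by (rule arg_cong)
  then have "p1 + p2 + p3 + p4 = a + b + c + d"
    using dp da by (simp add: add.assoc)
  then have "p1 + p2 + p3 + p4 = 2 *\<^sub>R (a + b + c - x)"
    unfolding abcd(3) C_orthocenter_eq by (simp add: algebra_simps scaleR_2)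
  then have z: "z = a + b + c - x"
    by (simp add: z_def)
  have d: "d = a + b + c - 2 *\<^sub>R x" using abcd(3) by (simp add: C_orthocenter_eq)
  define \<rho> where "\<rho> = norm (x - a)"
  have nx: "norm (x - a) = \<rho>" "norm (x - b) = \<rho>" "norm (x - c) = \<rho>"
    using abcd(2) by (simp_all add: circumcenters_def \<rho>_def)
  have nx': "norm (a - x) = \<rho>" "norm (b - x) = \<rho>" "norm (c - x) = \<rho>"
    using nx by (simp_all add: norm_minus_commute)
  have "norm (z - p - q) = \<rho>" if "p \<in> {a, b, c, d}" "q \<in> {a, b, c, d}" "p \<noteq> q" for p q
  proof -
    have eqs: "z - a - b = c - x" "z - a - c = b - x" "z - b - c = a - x"
      "z - a - d = x - a" "z - b - d = x - b" "z - c - d = x - c"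
      by (simp_all add: z d algebra_simps scaleR_2)
    have eqs': "z - b - a = c - x" "z - c - a = b - x" "z - c - b = a - x"
      "z - d - a = x - a" "z - d - b = x - b" "z - d - c = x - c"
      by (simp_all add: z d algebra_simps scaleR_2)
    show ?thesis
      using that(1,2) by (elim insertE emptyE) (use that(3) in \<open>simp_all only: eqs eqs' nx nx' simp_thms\<close>)
  qed
  then have "norm (z - p - q) = \<rho>" if "p \<in> ?P" "q \<in> ?P" "p \<noteq> q" for p q
    using that unfolding abcd(1) by blast
  from this[of p1 p3] this[of p2 p3] show "norm (z - p1 - p3) = norm (z - p2 - p3)"
    using dp by simp
qed

section \<open>From a Euclidean norm to the bisector property\<close>

lemma parallel_if_orthogonal:
  fixes k u v :: "'a::real_vector"
  assumes dim: "dim (UNIV :: 'a set) = 2" and B: "inner_product_form B"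
    and "k \<noteq> 0" "v \<noteq> 0" "B k v = 0" "B u v = 0"
  obtains r where "u = r *\<^sub>R k"
proof -
  have lin: "B (p *\<^sub>R x + q *\<^sub>R y) w = p * B x w + q * B y w" for p q x y w
  proof -
    have "bilinear B" using B by (simp add: inner_product_form_def)
    then show ?thesis by (simp add: bilinear_ladd bilinear_lmul)
  qed
  have pos: "B v v > 0" using B \<open>v \<noteq> 0\<close> by (simp add: inner_product_form_def)
  have "indep2 k v"
    unfolding indep2_def
  proof (intro allI impI)
    fix p q
    assume e: "p *\<^sub>R k + q *\<^sub>R v = 0"
    have "B 0 v = 0" using lin[of 0 0 0 0 v] by simp
    then have "q * B v v = 0" using lin[of p k q v v] e assms(5) by simp
    then have "q = 0" using pos by simp
    then show "p = 0 \<and> q = 0" using e \<open>k \<noteq> 0\<close> by simp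
  qed
  then obtain p q where pq: "u = p *\<^sub>R k + q *\<^sub>R v"
    using plane_coordinates[OF dim] by blast
  then have "q * B v v = 0" using lin[of p k q v v] assms(5,6) by simp
  then show ?thesis using that[of p] pq pos by simp
qed

lemma orthogonal_if_isosceles:
  fixes u v :: "'a::real_normed_vector"
  assumes B: "inner_product_form B" "\<And>x. norm x = sqrt (B x x)" and "norm (u + v) = norm (u - v)"
  shows "B u v = 0"
proof -
  have bl: "bilinear B" and sym: "B v u = B u v" using B(1) by (simp_all add: inner_product_form_def)
  have "B (u + v) (u + v) = B (u - v) (u - v)"
    using assms(3) B(2) by simp
  then show ?thesis
    using bilinear_ladd[OF bl] bilinear_radd[OF bl] bilinear_lsub[OF bl] bilinear_rsub[OF bl] sym
    by simp
qed

text \<open>The system gives \<open>norm (u + v) = norm (u - v)\<close>, and the equidistance of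
  \<open>p3\<close> gives the same with \<open>p3 - m\<close> for \<open>u\<close>. Both vectors are
  thus orthogonal to \<open>v\<close>, hence parallel, and \<open>p4 = p3 + 2 u\<close>.\<close>

lemma euclidean_orthocenter_on_bisector:
  fixes p1 p2 p3 p4 :: "'a::real_normed_vector"
  assumes dim: "dim (UNIV :: 'a set) = 2" and euc: "euclidean_norm TYPE('a)"
    and sys: "C_orthocentric_system {p1, p2, p3, p4}"
    and eq: "norm (p3 - p1) = norm (p3 - p2)" and ne: "p3 \<noteq> midpoint p1 p2"
  shows "p4 \<in> affine hull {p3, midpoint p1 p2}"
proof -
  obtain B :: "'a \<Rightarrow> 'a \<Rightarrow> real" where B: "inner_product_form B" "\<And>x. norm x = sqrt (B x x)"
    using euc unfolding euclidean_norm_def by blast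
  define m where "m = midpoint p1 p2"
  define v where "v = (1 / 2) *\<^sub>R (p2 - p1)"
  define u where "u = (1 / 2) *\<^sub>R (p4 - p3)"
  note norms = orthocentric_system_norms[OF sys]
  have v: "v \<noteq> 0" using norms(1) by (auto simp: v_def)
  have two: "x = (1 / 2) *\<^sub>R x + (1 / 2) *\<^sub>R x" for x :: 'a
    by (simp flip: scaleR_left_distrib)
  have half: "(1 / 2) *\<^sub>R (p1 + p2 + p3 + p4) - p1 - p3 = u + v"
    "(1 / 2) *\<^sub>R (p1 + p2 + p3 + p4) - p2 - p3 = u - v"
    "(p3 - m) + v = p3 - p1" "(p3 - m) - v = p3 - p2"
    using two[of p1] two[of p2] two[of p3]
    by (simp_all add: u_def v_def m_def midpoint_def inverse_eq_divide algebra_simps)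
  have "B u v = 0"
    using orthogonal_if_isosceles[OF B] norms(2) half by metis
  moreover have "B (p3 - m) v = 0"
    using orthogonal_if_isosceles[OF B] eq half by metis
  moreover have "p3 - m \<noteq> 0" using ne by (simp add: m_def)
  ultimately obtain r where r: "u = r *\<^sub>R (p3 - m)"
    using parallel_if_orthogonal[OF dim B(1) _ v] by blast
  have "p4 = p3 + 2 *\<^sub>R u" by (simp add: u_def)
  then have "p4 = (1 + 2 * r) *\<^sub>R p3 + (- 2 * r) *\<^sub>R m"
    using r by (simp add: algebra_simps)
  then show ?thesis
    unfolding affine_hull_2 m_def
    by (intro CollectI exI[of _ "1 + 2 * r"] exI[of _ "- 2 * r"]) simp
qed

section \<open>From the bisector property to \<open>bisecting_norm\<close>\<close>

lemma bisecting_norm_if_orthocenters_on_bisectors: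
  assumes "\<And>p1 p2 p3 p4 :: 'a::real_normed_vector.
       C_orthocentric_system {p1, p2, p3, p4} \<Longrightarrow>
       norm (p3 - p1) = norm (p3 - p2) \<Longrightarrow>
       p3 \<noteq> midpoint p1 p2 \<Longrightarrow>
       p4 \<in> affine hull {p3, midpoint p1 p2}"
  shows "bisecting_norm TYPE('a)"
proof
  fix a b c :: 'a
  assume unit: "norm a = 1" "norm b = 1" "norm c = 1"
    and ne: "a \<noteq> b" "a \<noteq> - b" "a \<noteq> c" "a \<noteq> - c" "b \<noteq> c" "b \<noteq> - c"
    and eq: "norm (c - a) = norm (c - b)"
  show "\<exists>k. a + b = k *\<^sub>R c"
  proof (cases "c = midpoint a b")
    case True
    then have "a + b = 2 *\<^sub>R c" by (simp add: midpoint_def)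
    then show ?thesis by blast
  next
    case False
    have "0 \<in> circumcenters a b c" using unit by (simp add: circumcenters_def)
    moreover have "a + b + c = C_orthocenter a b c 0" by (simp add: C_orthocenter_eq)
    moreover have "card {a, b, c, a + b + c} = 4"
    proof -
      have "b + c \<noteq> 0" "a + c \<noteq> 0" "a + b \<noteq> 0"
        using ne by (simp_all flip: eq_neg_iff_add_eq_0)
      moreover have "a + b + c = a + (b + c)" "a + b + c = b + (a + c)" "a + b + c = c + (a + b)"
        by (simp_all add: algebra_simps)
      ultimately have "a \<noteq> a + b + c" "b \<noteq> a + b + c" "c \<noteq> a + b + c"
        by (metis add_cancel_right_right)+
      then show ?thesis using ne by simp
    qed
    ultimately have "C_orthocentric_system {a, b, c, a + b + c}"
      unfolding C_orthocentric_system_def by blast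
    then have "a + b + c \<in> affine hull {c, midpoint a b}"
      using assms eq False by blast
    then obtain x y where xy: "x + y = 1" "a + b + c = x *\<^sub>R c + y *\<^sub>R midpoint a b"
      unfolding affine_hull_2 by blast
    have "a + b + c = x *\<^sub>R c + (y / 2) *\<^sub>R (a + b)"
      using xy(2) by (simp add: midpoint_def)
    moreover have "x = 1 - y" using xy(1) by simp
    ultimately have *: "(1 - y / 2) *\<^sub>R (a + b) = (- y) *\<^sub>R c"
      by (simp add: algebra_simps)
    \<comment> \<open>Otherwise \<open>y = 2\<close>, and the equation would give
      \<open>c = 0\<close>.\<close>
    have nz: "1 - y / 2 \<noteq> 0"
    proof
      assume z: "1 - y / 2 = 0"
      then have "(- y) *\<^sub>R c = 0" using * by simp
      then show False using z unit(3) by auto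
    qed
    have "a + b = (1 / (1 - y / 2)) *\<^sub>R ((1 - y / 2) *\<^sub>R (a + b))"
      using nz by simp
    also have "\<dots> = (- y / (1 - y / 2)) *\<^sub>R c"
      unfolding * by simp
    finally show ?thesis by blast
  qed
qed

theorem theorem3p7:
  assumes "minkowski_plane TYPE('a::real_normed_vector)"
  shows "euclidean_norm TYPE('a) \<longleftrightarrow>
    (\<forall>p1 p2 p3 p4 :: 'a.
       C_orthocentric_system {p1, p2, p3, p4} \<longrightarrow>
       norm (p3 - p1) = norm (p3 - p2) \<longrightarrow>
       p3 \<noteq> midpoint p1 p2 \<longrightarrow>
       p4 \<in> affine hull {p3, midpoint p1 p2})"
proof -
  have dim: "dim (UNIV :: 'a set) = 2"
    using assms by (simp add: minkowski_plane_def)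
  have "euclidean_norm TYPE('a)" if "bisecting_norm TYPE('a)"
  proof -
    interpret bisecting_norm "TYPE('a)" by (rule that)
    show ?thesis
      using euclidean_if_isosceles_homogeneous[OF dim isosceles_homogeneous] by blast
  qed
  then show ?thesis
    using euclidean_orthocenter_on_bisector[OF dim] bisecting_norm_if_orthocenters_on_bisectors
    by blast
qed

end
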